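(* Let $(C,\phi,F)$ be a semicoherent $n$-component system with $C=\{1,\ldots,n\}$ whose component lifetimes $T_1,\ldots,T_n$ have no ties, and let $d\colon 2^C\to\mathbb{R}$ be its signed domination function. For every nonempty set $M\subseteq C$ with $m=|M|$ and every $k\in\{1,\ldots,m\}$, the probability $p_M^{(k)}=\Pr(T_C=T_{k:M})$ satisfies $$ p_M^{(k)} = \sum_{A\subseteq C,\ |M\cap A|\leq m-k+1}d(A)\,\Pr\Big(T_{k:M}=\min_{i\in A}T_i\Big), $$ or equivalently, $$ p_M^{(k)} = \sum_{A\subseteq C}d(A)\,\Pr\Big(T_{k:M}=\min_{i\in A}T_i\Big). $$
   Context: $C=\{1,\ldots,n\}$ is the set of components. $T_1,\ldots,T_n$ are nonnegative real random variables on a common probability space (the component lifetimes), with joint c.d.f. $F$, and there are no ties: $\Pr(T_i=T_j)=0$ for all distinct $i,j\in C$. No independence is assumed. The structure function $\phi\colon\{0,1\}^n\to\{0,1\}$ is identified with a set function $\phi\colon 2^C\to\{0,1\}$ (identify $(x_1,\ldots,x_n)$ with $A=\{i: x_i=1\}$). The system is semicoherent: $\phi$ is nondecreasing in each variable, $\phi(\varnothing)=0$ and $\phi(C)=1$. The system lifetime is $T_C=\max_{A\subseteq C,\ \phi(A)=1}\min_{i\in A}T_i$. For nonempty $M\subseteq C$ with $m=|M|$, $T_{k:M}$ is the $k$th smallest of the variables $T_i$, $i\in M$ ($k$th order statistic). The signed domination function $d$ gives the coefficients of the unique multilinear expression $\phi(x_1,\ldots,x_n)=\sum_{A\subseteq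 C}d(A)\prod_{i\in A}x_i$; equivalently $d(A)=\sum_{B\subseteq A}(-1)^{|A|-|B|}\phi(B)$. The minimum over the empty set is $+\infty$. *)

theory Defs
  imports "HOL-Probability.Probability"
begin

text \<open>
  A structure function on the components \<open>{1..n}\<close> is written as a real-valued set function on the
  subsets of \<open>{1..n}\<close>; its values on other sets are irrelevant.
\<close>

definition semicoherent :: "nat \<Rightarrow> (nat set \<Rightarrow> real) \<Rightarrow> bool" where
  "semicoherent n \<phi> \<longleftrightarrow>
     (\<forall>A\<subseteq>{1..n}. \<phi> A \<in> {0, 1}) \<and>
     (\<forall>i\<in>{1..n}. \<forall>A\<subseteq>{1..n} - {i}. \<phi> A \<le> \<phi> (insert i A)) \<and>
     \<phi> {} = 0 \<and> \<phi> {1..n} = 1"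

definition signed_domination :: "(nat set \<Rightarrow> real) \<Rightarrow> nat set \<Rightarrow> real" where
  "signed_domination \<phi> A = (\<Sum>B\<in>Pow A. (-1) ^ (card A - card B) * \<phi> B)"

text \<open>
  The signed domination function is the unique family of coefficients of the multilinear
  expression of \<open>\<phi>\<close>; the 0-1 vector \<open>x\<close> is the indicator of the set \<open>S\<close>.
\<close>

lemma signed_domination_unique_multilinear:
  assumes C: "finite C"
  shows "(\<forall>S\<subseteq>C. \<phi> S = (\<Sum>A\<in>Pow C. c A * (\<Prod>i\<in>A. of_bool (i \<in> S)))) \<longleftrightarrow>
         (\<forall>A\<subseteq>C. c A = signed_domination \<phi> A)"
proof -
  have expand: "(\<Sum>A\<in>Pow C. c A * (\<Prod>i\<in>A. of_bool (i \<in> S))) = sum c (Pow S)"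
    if S: "S \<subseteq> C" for S and c :: "nat set \<Rightarrow> real"
  proof -
    have "(\<Prod>i\<in>A. of_bool (i \<in> S)) = (of_bool (A \<subseteq> S) :: real)" if "A \<in> Pow C" for A
    proof (cases "A \<subseteq> S")
      case True
      then show ?thesis by (auto intro!: prod.neutral)
    next
      case False
      moreover have "finite A" using C that finite_subset by auto
      ultimately show ?thesis by (auto simp: prod_zero_iff)
    qed
    then have "(\<Sum>A\<in>Pow C. c A * (\<Prod>i\<in>A. of_bool (i \<in> S))) = (\<Sum>A\<in>Pow C. c A * of_bool (A \<subseteq> S))"
      by (intro sum.cong) auto
    also have "\<dots> = sum c (Pow S)"
      using C S by (intro sum.mono_neutral_cong_right) auto
    finally show ?thesis .
  qed
  have inversion: "\<phi> S = sum (signed_domination \<phi>) (Pow S)" if S: "finite S" for S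
  proof -
    define g where "g A = (\<Sum>B\<in>Pow A. (-1) ^ card B * \<phi> B)" for A
    have "signed_domination \<phi> A = (-1) ^ card A * g A" if "A \<in> Pow S" for A
    proof -
      have "finite A" using S that finite_subset by auto
      then show ?thesis
        unfolding signed_domination_def g_def sum_distrib_left
        by (intro sum.cong refl)
          (simp add: card_mono flip: neg_one_power_add_eq_neg_one_power_diff power_add mult.assoc)
    qed
    then have "sum (signed_domination \<phi>) (Pow S) = (\<Sum>A\<in>Pow S. (-1) ^ card A * g A)"
      by (intro sum.cong) auto
    also have "\<dots> = \<phi> S"
      using S by (intro inclusion_exclusion_symmetric [symmetric]) (simp_all add: g_def)
    finally show ?thesis by simp
  qed
  show ?thesis
  proof
    assume L: "\<forall>S\<subseteq>C. \<phi> S = (\<Sum>A\<in>Pow C. c A * (\<Prod>i\<in>A. of_bool (i \<in> S)))"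
    show "\<forall>A\<subseteq>C. c A = signed_domination \<phi> A"
    proof (intro allI impI)
      fix A assume A: "A \<subseteq> C"
      have "c A = (\<Sum>B\<in>Pow A. (-1) ^ (card A - card B) * sum c (Pow B))"
        using A C finite_subset by (intro inclusion_exclusion_mobius) auto
      also have "\<dots> = signed_domination \<phi> A"
        unfolding signed_domination_def
      proof (intro sum.cong refl)
        fix B assume "B \<in> Pow A"
        then have "B \<subseteq> C" using A by auto
        then show "(-1) ^ (card A - card B) * sum c (Pow B) = (-1) ^ (card A - card B) * \<phi> B"
          using L expand[of B c] by simp
      qed
      finally show "c A = signed_domination \<phi> A" .
    qed
  next
    assume R: "\<forall>A\<subseteq>C. c A = signed_domination \<phi> A"
    show "\<forall>S\<subseteq>C. \<phi> S = (\<Sum>A\<in>Pow C. c A * (\<Prod>i\<in>A. of_bool (i \<in> S)))"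
    proof (intro allI impI)
      fix S assume S: "S \<subseteq> C"
      have "\<phi> S = sum (signed_domination \<phi>) (Pow S)"
        using inversion S C finite_subset by blast
      also have "\<dots> = sum c (Pow S)"
        using R S by (intro sum.cong) auto
      finally show "\<phi> S = (\<Sum>A\<in>Pow C. c A * (\<Prod>i\<in>A. of_bool (i \<in> S)))"
        using expand[OF S] by simp
    qed
  qed
qed

text \<open>
  Lifetimes are extended reals so that the minimum over the empty set is \<open>\<infinity>\<close>, which is the
  value of the infimum of the empty set; over a finite nonempty set the infimum is the minimum.
\<close>

definition min_lifetime :: "(nat \<Rightarrow> 'w \<Rightarrow> real) \<Rightarrow> nat set \<Rightarrow> 'w \<Rightarrow> ereal" where
  "min_lifetime T A \<omega> = (INF i\<in>A. ereal (T i \<omega>))"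

definition system_lifetime ::
    "nat \<Rightarrow> (nat set \<Rightarrow> real) \<Rightarrow> (nat \<Rightarrow> 'w \<Rightarrow> real) \<Rightarrow> 'w \<Rightarrow> ereal" where
  "system_lifetime n \<phi> T \<omega> = Max {min_lifetime T A \<omega> | A. A \<subseteq> {1..n} \<and> \<phi> A = 1}"

text \<open>
  The \<open>k\<close>th smallest of the values \<open>T i \<omega>\<close>, \<open>i \<in> M\<close>, counted with multiplicity, for
  \<open>1 \<le> k \<le> card M\<close>.
\<close>

definition order_statistic ::
    "(nat \<Rightarrow> 'w \<Rightarrow> real) \<Rightarrow> nat set \<Rightarrow> nat \<Rightarrow> 'w \<Rightarrow> real" where
  "order_statistic T M k \<omega> = sort (map (\<lambda>i. T i \<omega>) (sorted_list_of_set M)) ! (k - 1)"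

end

theory Submission
  imports Defs
begin

text \<open>
  The probabilistic identity is the expectation of a pointwise one. Fix an outcome and a real
  threshold \<open>x\<close>. The system survives \<open>x\<close> exactly when the set \<open>S\<close> of components that survive \<open>x\<close>
  has \<open>\<phi> S = 1\<close>, and all components of \<open>A\<close> survive \<open>x\<close> exactly when \<open>A \<subseteq> S\<close>. The multilinear
  expression of \<open>\<phi>\<close>, evaluated at the indicator of \<open>S\<close>, therefore writes the indicator of
  \<open>x \<le> T\<^sub>C\<close> as the combination with coefficients \<open>d A\<close> of the indicators of \<open>x \<le> min\<^sub>A T\<close>, where
  \<open>min\<^sub>A T\<close> is the smallest lifetime in \<open>A\<close>. The same holds with strict inequalities, and
  subtracting the two expressions gives
  \<open>[T\<^sub>C = x] = (\<Sum>A. d A * [min\<^sub>A T = x])\<close>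
  (\<open>of_bool_system_lifetime_eq\<close>). As \<open>x\<close> may depend on the outcome, it can be taken to be the
  order statistic; integrating yields the sum over all \<open>A\<close>.

  The restricted sum rests on the absence of ties. If \<open>min\<^sub>A T\<close> is the \<open>k\<close>th smallest
  lifetime in \<open>M\<close>, then every component of \<open>M \<inter> A\<close> lives at least that long, and without ties
  at most \<open>card M - k + 1\<close> components of \<open>M\<close> do (\<open>card_ge_order_statistic\<close>). The terms with
  larger \<open>M \<inter> A\<close> thus carry probability zero.
\<close>

section \<open>Survival of a threshold and the multilinear expression\<close>

lemma semicoherent_mono:
  assumes "semicoherent n \<phi>" "A \<subseteq> B" "B \<subseteq> {1..n}"
  shows "\<phi> A \<le> \<phi> B"
proof -
  have step: "\<forall>i\<in>{1..n}. \<forall>A\<subseteq>{1..n} - {i}. \<phi> A \<le> \<phi> (insert i A)"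
    using assms(1) by (simp add: semicoherent_def)
  have "finite B"
    using assms(3) finite_subset by blast
  then have "\<phi> A \<le> \<phi> (A \<union> D)" if "D \<subseteq> B - A" for D
  proof -
    have "finite D"
      using that \<open>finite B\<close> finite_subset by blast
    then show ?thesis
      using that
    proof (induction D)
      case (insert i D)
      have "i \<in> {1..n}" and "A \<union> D \<subseteq> {1..n} - {i}" and IH: "\<phi> A \<le> \<phi> (A \<union> D)"
        using assms(2,3) insert.hyps insert.prems insert.IH by blast+
      then have "\<phi> (A \<union> D) \<le> \<phi> (insert i (A \<union> D))"
        using step by blast
      with IH show ?case
        by simp
    qed simp
  qed
  from this[of "B - A"] show ?thesis
    using assms(2) by (simp add: Un_absorb1)
qed

text \<open>
  An up-closed property \<open>Q\<close> of lifetimes stands for survival of a threshold. Treating it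
  abstractly covers \<open>x \<le> _\<close> and \<open>x < _\<close> at once; the hypothesis on \<open>\<infinity>\<close> accounts for empty \<open>A\<close>.
\<close>

lemma min_lifetime_upclosed_iff:
  assumes "finite A" "mono Q" "Q \<infinity>"
  shows "Q (min_lifetime T A \<omega>) \<longleftrightarrow> (\<forall>i\<in>A. Q (ereal (T i \<omega>)))"
  using assms(1)
proof (induction A)
  case empty
  then show ?case
    using assms(3) by (simp add: min_lifetime_def top_ereal_def)
next
  case (insert i A)
  have "Q (min a b) \<longleftrightarrow> Q a \<and> Q b" for a b
    using monoD[OF assms(2), of a b] monoD[OF assms(2), of b a] by (auto simp: min_def)
  moreover have "min_lifetime T (insert i A) \<omega> = min (ereal (T i \<omega>)) (min_lifetime T A \<omega>)"
    by (simp add: min_lifetime_def inf_min)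
  ultimately show ?case
    using insert.IH by simp
qed

text \<open>
  A set on which \<open>\<phi>\<close> is 1 and all of whose components survive can be enlarged to the set of all
  surviving components, by monotonicity of \<open>\<phi>\<close>; so this single set decides whether the system
  survives.
\<close>

lemma system_lifetime_upclosed_iff:
  assumes \<phi>: "semicoherent n \<phi>" and Q: "mono Q" "Q \<infinity>"
  shows "Q (system_lifetime n \<phi> T \<omega>) \<longleftrightarrow> \<phi> {i\<in>{1..n}. Q (ereal (T i \<omega>))} = 1"
proof -
  let ?X = "{min_lifetime T A \<omega> | A. A \<subseteq> {1..n} \<and> \<phi> A = 1}"
  let ?S = "{i\<in>{1..n}. Q (ereal (T i \<omega>))}"
  have X: "finite ?X" "?X \<noteq> {}"
    using \<phi> by (auto simp: semicoherent_def)
  have Q_min: "Q (min_lifetime T A \<omega>) \<longleftrightarrow> A \<subseteq> ?S" if "A \<subseteq> {1..n}" for A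
    using min_lifetime_upclosed_iff[of A Q T \<omega>] that Q finite_subset by blast
  have "Q (Max ?X) \<longleftrightarrow> (\<exists>a\<in>?X. Q a)"
    using Max_in[OF X] Max_ge[OF X(1)] monoD[OF Q(1)] unfolding le_bool_def by blast
  also have "\<dots> \<longleftrightarrow> (\<exists>A\<subseteq>?S. \<phi> A = 1)"
    using Q_min by blast
  also have "\<dots> \<longleftrightarrow> \<phi> ?S = 1"
  proof
    assume "\<exists>A\<subseteq>?S. \<phi> A = 1"
    then obtain A where "A \<subseteq> ?S" "\<phi> A = 1"
      by blast
    moreover have "?S \<subseteq> {1..n}"
      by blast
    ultimately have "1 \<le> \<phi> ?S"
      using semicoherent_mono[OF \<phi>] by metis
    moreover have "\<phi> ?S \<in> {0, 1}"
      using \<phi> \<open>?S \<subseteq> {1..n}\<close> unfolding semicoherent_def by metis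
    ultimately show "\<phi> ?S = 1"
      by (metis insertE singletonD not_one_le_zero)
  next
    assume "\<phi> ?S = 1"
    then show "\<exists>A\<subseteq>?S. \<phi> A = 1"
      by (metis order_refl)
  qed
  finally show ?thesis
    by (simp add: system_lifetime_def)
qed

lemma of_bool_system_lifetime_upclosed:
  assumes \<phi>: "semicoherent n \<phi>" and Q: "mono Q" "Q \<infinity>"
  shows "of_bool (Q (system_lifetime n \<phi> T \<omega>)) =
           (\<Sum>A\<in>Pow {1..n}. signed_domination \<phi> A * of_bool (Q (min_lifetime T A \<omega>)))"
proof -
  let ?S = "{i\<in>{1..n}. Q (ereal (T i \<omega>))}"
  have multilinear: "\<forall>S\<subseteq>{1..n}. \<phi> S =
      (\<Sum>A\<in>Pow {1..n}. signed_domination \<phi> A * (\<Prod>i\<in>A. of_bool (i \<in> S)))"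
    by (rule iffD2[OF signed_domination_unique_multilinear]) auto
  have S: "?S \<subseteq> {1..n}"
    by blast
  then have "\<phi> ?S \<in> {0, 1}"
    using \<phi> unfolding semicoherent_def by metis
  then have "\<phi> ?S = of_bool (\<phi> ?S = 1)"
    by (cases "\<phi> ?S = 1") simp_all
  then have "of_bool (Q (system_lifetime n \<phi> T \<omega>)) = \<phi> ?S"
    unfolding system_lifetime_upclosed_iff[OF assms] by (rule sym)
  also have "\<phi> ?S = (\<Sum>A\<in>Pow {1..n}. signed_domination \<phi> A * (\<Prod>i\<in>A. of_bool (i \<in> ?S)))"
    by (rule multilinear[rule_format, OF S])
  also have "\<dots> = (\<Sum>A\<in>Pow {1..n}. signed_domination \<phi> A * of_bool (Q (min_lifetime T A \<omega>)))"
  proof (intro sum.cong refl arg_cong2[where f = "(*)"])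
    fix A assume A: "A \<in> Pow {1..n}"
    then have fin: "finite A"
      using finite_subset by blast
    have "(\<Prod>i\<in>A. of_bool (i \<in> ?S)) = (of_bool (\<forall>i\<in>A. i \<in> ?S) :: real)"
      using fin by (induction A) auto
    also have "(\<forall>i\<in>A. i \<in> ?S) \<longleftrightarrow> Q (min_lifetime T A \<omega>)"
      unfolding min_lifetime_upclosed_iff[OF fin Q] using A by blast
    finally show "(\<Prod>i\<in>A. of_bool (i \<in> ?S)) = (of_bool (Q (min_lifetime T A \<omega>)) :: real)" .
  qed
  finally show ?thesis .
qed

text \<open>
  Equality with \<open>x\<close> is survival of \<open>x\<close> in the weak but not in the strict sense, and the multilinear
  expression is linear. Since \<open>x\<close> is real, \<open>x < \<infinity>\<close>, so \<open>x < _\<close> holds at \<open>\<infinity>\<close> as required of a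
  survival property.
\<close>

lemma of_bool_system_lifetime_eq:
  assumes \<phi>: "semicoherent n \<phi>"
  shows "of_bool (system_lifetime n \<phi> T \<omega> = ereal x) =
           (\<Sum>A\<in>Pow {1..n}. signed_domination \<phi> A * of_bool (ereal x = min_lifetime T A \<omega>))"
proof -
  have eq_diff: "of_bool (ereal x = y) = of_bool (ereal x \<le> y) - (of_bool (ereal x < y) :: real)" for y
    by auto
  have "mono (\<lambda>y. ereal x \<le> y)" "mono (\<lambda>y. ereal x < y)"
    by (auto simp: mono_def)
  from this[THEN of_bool_system_lifetime_upclosed[OF \<phi>], of T \<omega>] show ?thesis
    unfolding eq_commute[of _ "ereal x"] eq_diff right_diff_distrib sum_subtractf by simp
qed

section \<open>Order statistics\<close>

lemma sorted_nth_le_iff_length_filter: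
  fixes xs :: "'a::linorder list"
  assumes "sorted xs" "j < length xs"
  shows "xs ! j \<le> x \<longleftrightarrow> j < length (filter (\<lambda>y. y \<le> x) xs)"
  using assms
proof (induction xs arbitrary: j)
  case (Cons a xs)
  show ?case
  proof (cases "a \<le> x")
    case True
    then show ?thesis
      using Cons by (cases j) auto
  next
    case False
    then have "filter (\<lambda>y. y \<le> x) (a # xs) = []"
      using Cons.prems by (auto simp: filter_empty_conv)
    moreover have "a \<le> (a # xs) ! j"
      using Cons.prems by (cases j) auto
    ultimately show ?thesis
      using False by auto
  qed
qed simp

text \<open>This is the form in which order statistics are used: a count replaces the sorting.\<close>

lemma order_statistic_le_iff:
  assumes "finite M" "k \<in> {1..card M}"
  shows "order_statistic T M k \<omega> \<le> x \<longleftrightarrow> k \<le> card {i\<in>M. T i \<omega> \<le> x}"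
proof -
  let ?ys = "map (\<lambda>i. T i \<omega>) (sorted_list_of_set M)"
  have "length (filter (\<lambda>y. y \<le> x) (sort ?ys)) =
          length (filter (\<lambda>i. T i \<omega> \<le> x) (sorted_list_of_set M))"
    by (simp add: filter_sort filter_map comp_def)
  also have "\<dots> = card {i\<in>M. T i \<omega> \<le> x}"
    using assms(1) by (simp flip: distinct_card)
  finally have count: "length (filter (\<lambda>y. y \<le> x) (sort ?ys)) = card {i\<in>M. T i \<omega> \<le> x}" .
  have k: "0 < k" "k - 1 < card M"
    using assms(2) by auto
  then have "order_statistic T M k \<omega> \<le> x \<longleftrightarrow> k - 1 < card {i\<in>M. T i \<omega> \<le> x}"
    using sorted_nth_le_iff_length_filter[of "sort ?ys" "k - 1" x] assms(1) count
    by (simp add: order_statistic_def)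
  with k(1) show ?thesis
    by linarith
qed

lemma borel_measurable_order_statistic:
  assumes "finite M" "k \<in> {1..card M}" and T: "\<And>i. i \<in> M \<Longrightarrow> T i \<in> borel_measurable P"
  shows "order_statistic T M k \<in> borel_measurable P"
proof (rule borel_measurableI_le)
  fix x
  have "order_statistic T M k \<omega> \<le> x \<longleftrightarrow> real k \<le> (\<Sum>i\<in>M. indicator {..x} (T i \<omega>))" for \<omega>
  proof -
    have "(\<Sum>i\<in>M. indicator {..x} (T i \<omega>)) = real (card {i\<in>M. T i \<omega> \<le> x})"
      using assms(1) by (simp add: indicator_def of_bool_def sum.If_cases Int_def)
    then show ?thesis
      using order_statistic_le_iff[OF assms(1,2)] by simp
  qed
  moreover have "(\<lambda>\<omega>. \<Sum>i\<in>M. indicator {..x} (T i \<omega>) :: real) \<in> borel_measurable P"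
    using T by (intro borel_measurable_sum) measurable
  ultimately show "{\<omega> \<in> space P. order_statistic T M k \<omega> \<le> x} \<in> sets P"
    by simp
qed

lemma card_ge_order_statistic:
  assumes "finite M" "k \<in> {1..card M}" and no_ties: "inj_on (\<lambda>i. T i \<omega>) M"
  shows "card {i\<in>M. order_statistic T M k \<omega> \<le> T i \<omega>} \<le> card M - k + 1"
proof -
  let ?t = "order_statistic T M k \<omega>"
  have "k \<le> card {i\<in>M. T i \<omega> \<le> ?t}"
    using order_statistic_le_iff[OF assms(1,2), of T \<omega> ?t] by simp
  moreover have "card {i\<in>M. T i \<omega> = ?t} \<le> 1"
    using assms(1) no_ties by (auto simp: card_le_Suc0_iff_eq inj_on_def)
  moreover have "card {i\<in>M. T i \<omega> \<le> ?t} + card {i\<in>M. ?t \<le> T i \<omega>} = card M + card {i\<in>M. T i \<omega> = ?t}"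
  proof -
    have "{i\<in>M. T i \<omega> \<le> ?t} \<union> {i\<in>M. ?t \<le> T i \<omega>} = M"
         "{i\<in>M. T i \<omega> \<le> ?t} \<inter> {i\<in>M. ?t \<le> T i \<omega>} = {i\<in>M. T i \<omega> = ?t}"
      by auto
    then show ?thesis
      using card_Un_Int[of "{i\<in>M. T i \<omega> \<le> ?t}" "{i\<in>M. ?t \<le> T i \<omega>}"] assms(1) by simp
  qed
  ultimately show ?thesis
    using assms(2) by simp
qed

section \<open>Integration\<close>

theorem theorem7:
  fixes P :: "'w measure" and n :: nat and \<phi> :: "nat set \<Rightarrow> real"
    and T :: "nat \<Rightarrow> 'w \<Rightarrow> real" and M :: "nat set" and k :: nat
  assumes "prob_space P"
    and "\<And>i. i \<in> {1..n} \<Longrightarrow> T i \<in> borel_measurable P"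
    and "\<And>i. i \<in> {1..n} \<Longrightarrow> AE \<omega> in P. 0 \<le> T i \<omega>"
    and "\<And>i j. i \<in> {1..n} \<Longrightarrow> j \<in> {1..n} \<Longrightarrow> i \<noteq> j \<Longrightarrow>
           measure P {\<omega> \<in> space P. T i \<omega> = T j \<omega>} = 0"
    and "semicoherent n \<phi>"
    and "M \<subseteq> {1..n}" and "M \<noteq> {}" and "k \<in> {1..card M}"
  shows "measure P {\<omega> \<in> space P. system_lifetime n \<phi> T \<omega> = ereal (order_statistic T M k \<omega>)} =
           (\<Sum>A | A \<subseteq> {1..n} \<and> card (M \<inter> A) \<le> card M - k + 1.
              signed_domination \<phi> A *
              measure P {\<omega> \<in> space P. ereal (order_statistic T M k \<omega>) = min_lifetime T A \<omega>}) \<and>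
         measure P {\<omega> \<in> space P. system_lifetime n \<phi> T \<omega> = ereal (order_statistic T M k \<omega>)} =
           (\<Sum>A | A \<subseteq> {1..n}.
              signed_domination \<phi> A *
              measure P {\<omega> \<in> space P. ereal (order_statistic T M k \<omega>) = min_lifetime T A \<omega>})"
proof -
  interpret prob_space P by fact
  note T = assms(2) and \<phi> = assms(5) and M = assms(6)
  let ?t = "order_statistic T M k"
  let ?E = "\<lambda>A. {\<omega> \<in> space P. ereal (?t \<omega>) = min_lifetime T A \<omega>}"
  let ?F = "{\<omega> \<in> space P. system_lifetime n \<phi> T \<omega> = ereal (?t \<omega>)}"
  let ?d = "signed_domination \<phi>"
  have finite_M: "finite M"
    using M finite_subset by blast
  have t: "?t \<in> borel_measurable P"
    using finite_M M T assms(8) by (intro borel_measurable_order_statistic) auto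
  have E: "?E A \<in> sets P" if "A \<subseteq> {1..n}" for A
  proof -
    have "(\<lambda>\<omega>. INF i\<in>A. ereal (T i \<omega>)) \<in> borel_measurable P"
      using that T finite_subset[OF that]
      by (intro borel_measurable_INF borel_measurable_ereal) (auto intro: countable_finite)
    with t show ?thesis
      unfolding min_lifetime_def by measurable
  qed

  have pointwise: "indicator ?F \<omega> = (\<Sum>A\<in>Pow {1..n}. ?d A * indicator (?E A) \<omega>)"
    if "\<omega> \<in> space P" for \<omega>
  proof -
    have "indicator ?F \<omega> = (of_bool (system_lifetime n \<phi> T \<omega> = ereal (?t \<omega>)) :: real)"
      and "\<And>A. indicator (?E A) \<omega> = (of_bool (ereal (?t \<omega>) = min_lifetime T A \<omega>) :: real)"
      using that by (simp_all add: indicator_def)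
    then show ?thesis
      by (simp only: of_bool_system_lifetime_eq[OF \<phi>])
  qed
  have "prob ?F = (\<integral>\<omega>. indicator ?F \<omega> \<partial>P)"
    by (simp add: Int_def conj_commute)
  also have "\<dots> = (\<integral>\<omega>. (\<Sum>A\<in>Pow {1..n}. ?d A * indicator (?E A) \<omega>) \<partial>P)"
    by (intro Bochner_Integration.integral_cong refl pointwise)
  also have "\<dots> = (\<Sum>A\<in>Pow {1..n}. ?d A * prob (?E A))"
    using E by (subst Bochner_Integration.integral_sum) (auto simp: emeasure_eq_measure Int_def conj_commute)
  also have "\<dots> = (\<Sum>A | A \<subseteq> {1..n}. ?d A * prob (?E A))"
    by (simp add: Pow_def)
  finally have full_sum: "prob ?F = (\<Sum>A | A \<subseteq> {1..n}. ?d A * prob (?E A))" .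

  have no_ties: "AE \<omega> in P. inj_on (\<lambda>i. T i \<omega>) M"
  proof -
    have "AE \<omega> in P. T i \<omega> \<noteq> T j \<omega>" if "i \<in> M" "j \<in> M" "i \<noteq> j" for i j
    proof (rule AE_I)
      have ij: "i \<in> {1..n}" "j \<in> {1..n}"
        using that M by auto
      from T[OF ij(1)] T[OF ij(2)] show "{\<omega> \<in> space P. T i \<omega> = T j \<omega>} \<in> sets P"
        by measurable
      show "emeasure P {\<omega> \<in> space P. T i \<omega> = T j \<omega>} = 0"
        using assms(4)[OF ij that(3)] by (simp add: emeasure_eq_measure)
    qed auto
    then have "AE \<omega> in P. \<forall>i\<in>M. \<forall>j\<in>M. i \<noteq> j \<longrightarrow> T i \<omega> \<noteq> T j \<omega>"
      using finite_M by (intro AE_finite_allI) auto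
    then show ?thesis
      by eventually_elim (auto simp: inj_on_def)
  qed
  \<comment> \<open>An oversized \<open>M \<inter> A\<close> above the order statistic would force a tie within \<open>M\<close>.\<close>
  have "prob (?E A) = 0" if "A \<subseteq> {1..n}" "card M - k + 1 < card (M \<inter> A)" for A
  proof -
    have "AE \<omega> in P. \<omega> \<notin> ?E A"
      using no_ties
    proof eventually_elim
      case (elim \<omega>)
      show ?case
      proof
        assume "\<omega> \<in> ?E A"
        then have "ereal (?t \<omega>) \<le> ereal (T i \<omega>)" if "i \<in> A" for i
          using that by (auto simp: min_lifetime_def intro: INF_lower)
        then have "card (M \<inter> A) \<le> card {i\<in>M. ?t \<omega> \<le> T i \<omega>}"
          using finite_M by (intro card_mono) auto
        then show False
          using card_ge_order_statistic[of M k T \<omega>, OF finite_M assms(8) elim] that(2) by simp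
      qed
    qed
    then show ?thesis
      using E[OF that(1)] by (simp add: prob_eq_0)
  qed
  then have "(\<Sum>A | A \<subseteq> {1..n}. ?d A * prob (?E A)) =
      (\<Sum>A | A \<subseteq> {1..n} \<and> card (M \<inter> A) \<le> card M - k + 1. ?d A * prob (?E A))"
    by (intro sum.mono_neutral_right) (auto simp: not_le)
  with full_sum show ?thesis
    by simp
qed

end
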